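(* Let $a,b,c,d>0$ be real with $a+b\ne c+d$, and put $\sigma=(a+b-c-d)^{-1}$, $e_1=a+b+c+d$. The operators $L,M_1,M_2$ acting on $\mathbb{C}[x^2]$ define a representation of the algebra $\mathfrak{stab}$ on the space spanned by the scaled Wilson polynomials $\tilde W_n$, in which the elements $$\mu=-P(2a-1,2b-1),\qquad \mu^{*}=-P(2c,2d),\qquad \tau=4L$$ act, for all $n\ge0$, by $$\mu\cdot\tilde W_n(x^2|a,b,c,d)=-(n+a+b-1)\,\tilde W_n\big(x^2\big|a-\tfrac12,b-\tfrac12,c+\tfrac12,d+\tfrac12\big),$$ $$\tau\cdot\tilde W_n(x^2|a,b,c,d)=n(n+e_1-1)\,\tilde W_{n-1}\big(x^2\big|a+\tfrac12,b+\tfrac12,c+\tfrac12,d+\tfrac12\big),$$ $$\begin{aligned}\mu^{*}\cdot\tilde W_n(x^2|a,b,c,d)=&-\sigma(n+a+b-1)\,\tilde W_n\big(x^2\big|a-\tfrac12,b-\tfrac12,c+\tfrac12,d+\tfrac12\big)\\&-(1-\sigma)(n+c+d-1)\,\tilde W_n\big(x^2\big|a+\tfrac12,b+\tfrac12,c-\tfrac12,d-\tfrac12\big)\\&+\Big[\sigma(ab-cd)-\tfrac12(c+d)-\tfrac14\Big]n(n+e_1-1)\,\tilde W_{n-1}\big(x^2\big|a+\tfrac12,b+\tfrac12,c+\tfrac12,d+\tfrac12\big),\end{aligned}$$ where terms containing $\tilde W_{-1}$ are zero.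
   Context: $\mathfrak{stab}$ is the unital associative algebra over $\mathbb{C}$ generated by $L,M_1,M_2$ with relations $$[L,M_1]=2L^2,\quad [L,M_2]=\{M_1,L\},\quad [M_1,M_2]=\{M_2,L\}-4L^2,$$ where $[A,B]=AB-BA$, $\{A,B\}=AB+BA$. It is realized on $\mathbb{C}[x^2]$ (even polynomials in $x$) by $$L=\tfrac{1}{4x}(T^+-T^-),\quad M_1=\tfrac1{4x}\big[(2x-1)T^++(2x+1)T^-\big],\quad M_2=\tfrac1{4x}\big[(2x^2-2x+1)T^+-(2x^2+2x+1)T^-\big],$$ with $T^{\pm}f(x)=f(x\pm1)$. For parameters $s,t$, $$P(s,t)=uL+vM_1+wM_2,\qquad u=\tfrac{(1+2s)(1+2t)-1}{4},\quad v=\tfrac12(1+s+t),\quad w=\tfrac12 .$$ The Wilson polynomials are $$W_n(x^2|a,b,c,d)=(a+b)_n(a+c)_n(a+d)_n\;{}_4F_3\!\left(\begin{matrix}-n,\,n+a+b+c+d-1,\,a+ix,\,a-ix\\ a+b,\,a+c,\,a+d\end{matrix}\Big|1\right),$$ understood, for arbitrary parameters, as the polynomial $\sum_{k=0}^n\frac{(-n)_k(n+a+b+c+d-1)_k(a+ix)_k(a-ix)_k}{k!}(a+b+k)_{n-k}(a+c+k)_{n-k}(a+d+k)_{n-k}$, where $(y)_k=y(y+1)\cdots(y+k-1)$. The scaled polynomials are $\tilde W_n(x^2|a,b,c,d)=W_n\big(-\tfrac{x^2}{4}\big|a,b,c,d\big)$, i.e. $x^2$ is replaced by $-x^2/4$.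 *)

theory Defs
  imports
    Complex_Main
    "HOL-Library.Poly_Mapping"
    "HOL-Computational_Algebra.Polynomial"
begin

section \<open>The algebra \<open>stab\<close>\<close>

definition commutator :: "'a::ring \<Rightarrow> 'a \<Rightarrow> 'a"
  where "commutator A B = A * B - B * A"

definition anticommutator :: "'a::ring \<Rightarrow> 'a \<Rightarrow> 'a"
  where "anticommutator A B = A * B + B * A"

datatype stab_gen = GL | GM1 | GM2

text \<open>
  The free monoid on the three generators. It is written additively because the
  convolution product of \<^theory>\<open>HOL-Library.Poly_Mapping\<close> expects an additive
  (not necessarily commutative) monoid of exponents.
\<close>

datatype stab_word = Word (letters: "stab_gen list")

instantiation stab_word :: monoid_add
begin

definition zero_stab_word :: stab_word
  where "zero_stab_word = Word []"

definition plus_stab_word :: "stab_word \<Rightarrow> stab_word \<Rightarrow> stab_word"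
  where "plus_stab_word u v = Word (letters u @ letters v)"

instance
  by standard (simp_all add: zero_stab_word_def plus_stab_word_def)

end

text \<open>The free unital associative complex algebra on the three generators.\<close>

type_synonym stab_free = "stab_word \<Rightarrow>\<^sub>0 complex"

definition free_gen :: "stab_gen \<Rightarrow> stab_free"
  where "free_gen g = Poly_Mapping.single (Word [g]) 1"

definition free_scale :: "complex \<Rightarrow> stab_free \<Rightarrow> stab_free"
  where "free_scale c p = Poly_Mapping.single 0 c * p"

definition stab_relators :: "stab_free set"
  where "stab_relators =
    (let L = free_gen GL; M1 = free_gen GM1; M2 = free_gen GM2 in
     {commutator L M1 - 2 * L ^ 2,
      commutator L M2 - anticommutator M1 L,
      commutator M1 M2 - (anticommutator M2 L - 4 * L ^ 2)})"

text \<open>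
  The two-sided ideal generated by the relators. Closure under multiplication from both
  sides subsumes closure under scalars, since these are embedded in the free algebra.
\<close>

inductive_set stab_ideal :: "stab_free set"
  where
    stab_ideal_relator: "r \<in> stab_relators \<Longrightarrow> r \<in> stab_ideal"
  | stab_ideal_zero: "0 \<in> stab_ideal"
  | stab_ideal_add: "p \<in> stab_ideal \<Longrightarrow> q \<in> stab_ideal \<Longrightarrow> p + q \<in> stab_ideal"
  | stab_ideal_mult_left: "p \<in> stab_ideal \<Longrightarrow> q * p \<in> stab_ideal"
  | stab_ideal_mult_right: "p \<in> stab_ideal \<Longrightarrow> p * q \<in> stab_ideal"

lemma stab_ideal_uminus: "p \<in> stab_ideal \<Longrightarrow> - p \<in> stab_ideal"
  using stab_ideal_mult_left[of p "- 1"] by simp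

lemma stab_ideal_diff: "p \<in> stab_ideal \<Longrightarrow> q \<in> stab_ideal \<Longrightarrow> p - q \<in> stab_ideal"
  using stab_ideal_add[of p "- q"] stab_ideal_uminus[of q] by simp

definition stab_eq :: "stab_free \<Rightarrow> stab_free \<Rightarrow> bool"
  where "stab_eq p q \<longleftrightarrow> p - q \<in> stab_ideal"

lemma equivp_stab_eq: "equivp stab_eq"
proof (rule equivpI)
  show "reflp stab_eq"
    by (simp add: reflp_def stab_eq_def stab_ideal_zero)
  show "symp stab_eq"
  proof (rule sympI)
    fix p q assume "stab_eq p q"
    then show "stab_eq q p"
      using stab_ideal_uminus[of "p - q"] by (simp add: stab_eq_def)
  qed
  show "transp stab_eq"
  proof (rule transpI)
    fix p q r assume "stab_eq p q" "stab_eq q r"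
    then show "stab_eq p r"
      using stab_ideal_add[of "p - q" "q - r"] by (simp add: stab_eq_def)
  qed
qed

quotient_type stab = stab_free / stab_eq
  by (rule equivp_stab_eq)

instantiation stab :: "{ring, monoid_mult}"
begin

lift_definition zero_stab :: stab is 0 .

lift_definition one_stab :: stab is 1 .

lift_definition plus_stab :: "stab \<Rightarrow> stab \<Rightarrow> stab" is "(+)"
  unfolding stab_eq_def by (simp only: add_diff_add stab_ideal_add)

lift_definition uminus_stab :: "stab \<Rightarrow> stab" is uminus
  unfolding stab_eq_def by (simp only: minus_diff_minus stab_ideal_uminus)

lift_definition minus_stab :: "stab \<Rightarrow> stab \<Rightarrow> stab" is "(-)"
proof -
  fix p p' q q' :: stab_free
  assume "stab_eq p p'" "stab_eq q q'"
  then have "(p - p') - (q - q') \<in> stab_ideal"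
    unfolding stab_eq_def by (rule stab_ideal_diff)
  then show "stab_eq (p - q) (p' - q')"
    by (simp add: stab_eq_def algebra_simps)
qed

lift_definition times_stab :: "stab \<Rightarrow> stab \<Rightarrow> stab" is "(*)"
proof -
  fix p p' q q' :: stab_free
  assume "stab_eq p p'" "stab_eq q q'"
  then have "(p - p') * q + p' * (q - q') \<in> stab_ideal"
    unfolding stab_eq_def
    by (intro stab_ideal_add stab_ideal_mult_left stab_ideal_mult_right)
  then show "stab_eq (p * q) (p' * q')"
    by (simp add: stab_eq_def algebra_simps)
qed

instance
  by standard
    (transfer; simp add: stab_eq_def algebra_simps stab_ideal_zero)+

end

lift_definition stab_scale :: "complex \<Rightarrow> stab \<Rightarrow> stab" is free_scale
  by (simp add: stab_eq_def free_scale_def stab_ideal_mult_left flip: right_diff_distrib)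

lift_definition stab_L :: stab is "free_gen GL" .
lift_definition stab_M1 :: stab is "free_gen GM1" .
lift_definition stab_M2 :: stab is "free_gen GM2" .

lemma single_zero_commute:
  fixes p :: stab_free
  shows "p * Poly_Mapping.single 0 c = Poly_Mapping.single 0 c * p"
proof (induction p rule: update_induct)
  case const
  then show ?case by simp
next
  case (update f k v)
  have "Poly_Mapping.update k v f = f + Poly_Mapping.single k v"
    using update.hyps
    by (intro poly_mapping_eqI)
      (auto simp: lookup_update lookup_add lookup_single when_def in_keys_iff)
  then show ?case
    using update.IH by (simp add: distrib_left distrib_right mult_single mult.commute)
qed

lemma
  shows stab_scale_add_right: "stab_scale c (A + B) = stab_scale c A + stab_scale c B"
    and stab_scale_add_left: "stab_scale (c + d) A = stab_scale c A + stab_scale d A"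
    and stab_scale_scale: "stab_scale c (stab_scale d A) = stab_scale (c * d) A"
    and stab_scale_one: "stab_scale 1 A = A"
    and stab_scale_mult_left: "stab_scale c A * B = stab_scale c (A * B)"
    and stab_scale_mult_right: "A * stab_scale c B = stab_scale c (A * B)"
proof -
  show "stab_scale c (A + B) = stab_scale c A + stab_scale c B"
    by transfer (simp add: stab_eq_def free_scale_def distrib_left stab_ideal_zero)
  show "stab_scale (c + d) A = stab_scale c A + stab_scale d A"
    by transfer (simp add: stab_eq_def free_scale_def single_add distrib_right stab_ideal_zero)
  show "stab_scale c (stab_scale d A) = stab_scale (c * d) A"
    by transfer (simp add: stab_eq_def free_scale_def mult_single stab_ideal_zero
        flip: mult.assoc)
  show "stab_scale 1 A = A"
    by transfer (simp add: stab_eq_def free_scale_def stab_ideal_zero)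
  show "stab_scale c A * B = stab_scale c (A * B)"
    by transfer (simp add: stab_eq_def free_scale_def mult.assoc stab_ideal_zero)
  show "A * stab_scale c B = stab_scale c (A * B)"
    by transfer (simp add: stab_eq_def free_scale_def single_zero_commute stab_ideal_zero
        flip: mult.assoc)
qed

lemma
  shows stab_relation_L_M1:
      "commutator stab_L stab_M1 = stab_scale 2 (stab_L ^ 2)"
    and stab_relation_L_M2:
      "commutator stab_L stab_M2 = anticommutator stab_M1 stab_L"
    and stab_relation_M1_M2:
      "commutator stab_M1 stab_M2 = anticommutator stab_M2 stab_L - stab_scale 4 (stab_L ^ 2)"
proof -
  let ?L = "free_gen GL" and ?M1 = "free_gen GM1" and ?M2 = "free_gen GM2"
  have *: "free_scale (numeral m) p = numeral m * p" for m p
    by (metis free_scale_def single_numeral)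
  have rels:
    "?L * ?M1 - ?M1 * ?L - 2 * (?L * ?L) \<in> stab_ideal"
    "?L * ?M2 - ?M2 * ?L - (?M1 * ?L + ?L * ?M1) \<in> stab_ideal"
    "?M1 * ?M2 - ?M2 * ?M1 - (?M2 * ?L + ?L * ?M2 - 4 * (?L * ?L)) \<in> stab_ideal"
    by (rule stab_ideal_relator,
        simp add: stab_relators_def Let_def commutator_def anticommutator_def
          power2_eq_square)+
  show "commutator stab_L stab_M1 = stab_scale 2 (stab_L ^ 2)"
    unfolding commutator_def power2_eq_square
    by transfer (simp only: stab_eq_def * rels)
  show "commutator stab_L stab_M2 = anticommutator stab_M1 stab_L"
    unfolding commutator_def anticommutator_def
    by transfer (simp only: stab_eq_def rels)
  show "commutator stab_M1 stab_M2 = anticommutator stab_M2 stab_L - stab_scale 4 (stab_L ^ 2)"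
    unfolding commutator_def anticommutator_def power2_eq_square
    by transfer (simp only: stab_eq_def * rels)
qed

definition stab_P :: "complex \<Rightarrow> complex \<Rightarrow> stab"
  where "stab_P s t =
    stab_scale (((1 + 2 * s) * (1 + 2 * t) - 1) / 4) stab_L
    + stab_scale ((1 + s + t) / 2) stab_M1
    + stab_scale (1 / 2) stab_M2"


section \<open>Representations on spaces of polynomials\<close>

global_interpretation cpoly: vector_space "smult :: complex \<Rightarrow> complex poly \<Rightarrow> complex poly"
  by standard (simp_all add: smult_add_right smult_add_left)

text \<open>
  \<open>\<rho>\<close> is a unital algebra homomorphism from \<open>stab\<close> to the linear endomorphisms of the
  subspace \<open>V\<close>; the values of \<open>\<rho> A\<close> outside \<open>V\<close> are irrelevant.
\<close>

definition stab_representation ::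
    "complex poly set \<Rightarrow> (stab \<Rightarrow> complex poly \<Rightarrow> complex poly) \<Rightarrow> bool"
  where "stab_representation V \<rho> \<longleftrightarrow>
    cpoly.subspace V \<and>
    (\<forall>A. \<forall>f\<in>V. \<rho> A f \<in> V) \<and>
    (\<forall>A. \<forall>f\<in>V. \<forall>g\<in>V. \<rho> A (f + g) = \<rho> A f + \<rho> A g) \<and>
    (\<forall>A c. \<forall>f\<in>V. \<rho> A (smult c f) = smult c (\<rho> A f)) \<and>
    (\<forall>f\<in>V. \<rho> 1 f = f) \<and>
    (\<forall>A B. \<forall>f\<in>V. \<rho> (A + B) f = \<rho> A f + \<rho> B f) \<and>
    (\<forall>c A. \<forall>f\<in>V. \<rho> (stab_scale c A) f = smult c (\<rho> A f)) \<and>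
    (\<forall>A B. \<forall>f\<in>V. \<rho> (A * B) f = \<rho> A (\<rho> B f))"


section \<open>The difference operators\<close>

text \<open>\<open>even_polys\<close> is the space of polynomials in the square of the variable.\<close>

definition even_polys :: "complex poly set"
  where "even_polys = {f. f \<circ>\<^sub>p [:0, - 1:] = f}"

definition shift_up :: "complex poly \<Rightarrow> complex poly"
  where "shift_up f = f \<circ>\<^sub>p [:1, 1:]"

definition shift_down :: "complex poly \<Rightarrow> complex poly"
  where "shift_down f = f \<circ>\<^sub>p [:- 1, 1:]"

text \<open>
  The polynomial divisions below are exact on \<^const>\<open>even_polys\<close>
  (see \<open>poly_op_L\<close>, \<open>poly_op_M1\<close>, \<open>poly_op_M2\<close>).
\<close>

definition op_L :: "complex poly \<Rightarrow> complex poly"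
  where "op_L f = (shift_up f - shift_down f) div [:0, 4:]"

definition op_M1 :: "complex poly \<Rightarrow> complex poly"
  where "op_M1 f = ([:- 1, 2:] * shift_up f + [:1, 2:] * shift_down f) div [:0, 4:]"

definition op_M2 :: "complex poly \<Rightarrow> complex poly"
  where "op_M2 f = ([:1, - 2, 2:] * shift_up f - [:1, 2, 2:] * shift_down f) div [:0, 4:]"

lemma poly_even_polys: "f \<in> even_polys \<Longrightarrow> poly f (- x) = poly f x"
  using poly_pcompose[of f "[:0, - 1:]" x] by (simp add: even_polys_def)

lemma poly_div_4x:
  fixes p :: "complex poly"
  assumes "poly p 0 = 0" and "x \<noteq> 0"
  shows "poly (p div [:0, 4:]) x = poly p x / (4 * x)"
proof -
  obtain q where q: "p = [:0, 1:] * q"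
    using assms(1) poly_eq_0_iff_dvd[of p 0] by (auto elim: dvdE)
  then have "p = [:0, 4:] * smult (1 / 4) q"
    by simp
  moreover from this have "p div [:0, 4:] = smult (1 / 4) q"
    using nonzero_mult_div_cancel_left[of "[:0, 4:]" "smult (1 / 4) q"] by simp
  ultimately show ?thesis
    using assms(2) by simp
qed

lemma
  assumes "f \<in> even_polys" and "x \<noteq> 0"
  shows poly_op_L: "poly (op_L f) x = (poly f (x + 1) - poly f (x - 1)) / (4 * x)"
    and poly_op_M1: "poly (op_M1 f) x =
      ((2 * x - 1) * poly f (x + 1) + (2 * x + 1) * poly f (x - 1)) / (4 * x)"
    and poly_op_M2: "poly (op_M2 f) x =
      ((2 * x\<^sup>2 - 2 * x + 1) * poly f (x + 1)
        - (2 * x\<^sup>2 + 2 * x + 1) * poly f (x - 1)) / (4 * x)"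
  using poly_even_polys[OF assms(1), of 1] assms(2)
  by (simp_all add: op_L_def op_M1_def op_M2_def shift_up_def shift_down_def poly_div_4x
      poly_pcompose power2_eq_square algebra_simps)


section \<open>Wilson polynomials\<close>

text \<open>
  The Wilson polynomial is given as a polynomial in \<open>x\<close>; it lies in \<^const>\<open>even_polys\<close>.
  Since it is even, replacing \<open>x\<^sup>2\<close> by \<open>- x\<^sup>2 / 4\<close> amounts to replacing \<open>x\<close> by \<open>\<i> x / 2\<close>.
\<close>

definition wilson_coeff ::
    "nat \<Rightarrow> complex \<Rightarrow> complex \<Rightarrow> complex \<Rightarrow> complex \<Rightarrow> nat \<Rightarrow> complex"
  where "wilson_coeff n a b c d k =
    pochhammer (- of_nat n) k * pochhammer (of_nat n + a + b + c + d - 1) k / fact k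
    * pochhammer (a + b + of_nat k) (n - k)
    * pochhammer (a + c + of_nat k) (n - k)
    * pochhammer (a + d + of_nat k) (n - k)"

definition wilson ::
    "nat \<Rightarrow> complex \<Rightarrow> complex \<Rightarrow> complex \<Rightarrow> complex \<Rightarrow> complex poly"
  where "wilson n a b c d =
    (\<Sum>k\<le>n. smult (wilson_coeff n a b c d k) (pochhammer [:a, \<i>:] k * pochhammer [:a, - \<i>:] k))"

definition scaled_wilson ::
    "nat \<Rightarrow> complex \<Rightarrow> complex \<Rightarrow> complex \<Rightarrow> complex \<Rightarrow> complex poly"
  where "scaled_wilson n a b c d = wilson n a b c d \<circ>\<^sub>p [:0, \<i> / 2:]"

lemma wilson_even: "wilson n a b c d \<in> even_polys"
proof -
  have "(pochhammer [:a, z:] k) \<circ>\<^sub>p [:0, - 1:] = pochhammer [:a, - z:] k" for z k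
    by (simp add: pochhammer_prod pcompose_prod pcompose_pCons pcompose_add of_nat_poly)
  then show ?thesis
    by (simp add: even_polys_def wilson_def pcompose_sum pcompose_smult pcompose_mult mult.commute)
qed

lemma scaled_wilson_even: "scaled_wilson n a b c d \<in> even_polys"
proof -
  have "scaled_wilson n a b c d \<circ>\<^sub>p [:0, - 1:]
      = (wilson n a b c d \<circ>\<^sub>p [:0, - 1:]) \<circ>\<^sub>p [:0, \<i> / 2:]"
    unfolding scaled_wilson_def by (simp add: pcompose_pCons flip: pcompose_assoc)
  then show ?thesis
    using wilson_even by (simp add: even_polys_def scaled_wilson_def)
qed

lemma poly_scaled_wilson:
  "poly (scaled_wilson n a b c d) x =
    (\<Sum>k\<le>n. wilson_coeff n a b c d k * (pochhammer (a - x / 2) k * pochhammer (a + x / 2) k))"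
proof -
  have "poly (pochhammer [:a, z:] k) y = pochhammer (a + y * z) k" for y z k
    by (simp add: pochhammer_prod poly_prod of_nat_poly algebra_simps)
  then show ?thesis
    by (simp add: scaled_wilson_def wilson_def poly_pcompose poly_sum field_simps)
qed

end

theory Submission
  imports Defs
begin

text \<open>
  For even \<open>f\<close>, the element \<open>P(s,t)\<close> acts as
  \<open>((x + s)(x + t) f(x + 1) - (x - s)(x - t) f(x - 1)) / (4x)\<close>. On the Wilson basis
  \<open>\<phi>\<^sub>k(a; x) = (a - x/2)\<^sub>k (a + x/2)\<^sub>k\<close> this gives
  \<open>L \<phi>\<^sub>k(a) = -(k/4) \<phi>\<^bsub>k-1\<^esub>(a + 1/2)\<close>,
  \<open>-P(2a - 1, 2b - 1) \<phi>\<^sub>k(a) = -(a + b - 1 + k) \<phi>\<^sub>k(a - 1/2)\<close> and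
  \<open>-P(2c - 1, 2d - 1) \<phi>\<^sub>k(a) = -(c + d - 1 + k) \<phi>\<^sub>k(a + 1/2)
    + k (a + c + k - 1)(a + d + k - 1) \<phi>\<^bsub>k-1\<^esub>(a + 1/2)\<close>.
  The first two formulas yield \<open>\<tau>\<close> and \<open>\<mu>\<close> by comparison of coefficients. The third shows, without
  appeal to the symmetry of Wilson polynomials in their parameters, that \<open>\<nu> = -P(2c - 1, 2d - 1)\<close>
  shifts \<open>c, d\<close> down and \<open>a, b\<close> up. The formula for \<open>\<mu>\<^sup>*\<close> then follows from
  \<open>\<mu>\<^sup>* = \<sigma> \<mu> + (1 - \<sigma>) \<nu> + (\<sigma> (ab - cd) - (c + d)/2 - 1/4) \<tau>\<close>, where \<open>\<sigma>\<close> is the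
  value for which the terms of first degree in \<open>x\<close> agree.
  Since \<open>W\<^sub>n\<close> has degree exactly \<open>n\<close> in \<open>x\<^sup>2\<close> for positive parameters, the span is the
  space of all even polynomials.
\<close>

section \<open>The operators on even polynomials\<close>

text \<open>Finitely many points may be ignored, so operator identities can be checked away from the
  poles, where \<open>div\<close> by \<open>[:0, 4:]\<close> is ordinary division.\<close>

lemma poly_eqI_cofinite:
  fixes p q :: "complex poly"
  assumes "finite S" and "\<And>x. x \<notin> S \<Longrightarrow> poly p x = poly q x"
  shows "p = q"
proof (rule ccontr)
  assume "p \<noteq> q"
  then have "finite {x. poly (p - q) x = 0}"
    by (intro poly_roots_finite) simp
  moreover have "UNIV - S \<subseteq> {x. poly (p - q) x = 0}"
    using assms(2) by auto
  ultimately have "finite (UNIV - S)"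
    by (rule rev_finite_subset)
  then show False
    using assms(1) by (simp add: infinite_UNIV_char_0)
qed

section \<open>Linearity and parity of the difference operators\<close>

lemma
  shows op_L_add: "op_L (f + g) = op_L f + op_L g"
    and op_M1_add: "op_M1 (f + g) = op_M1 f + op_M1 g"
    and op_M2_add: "op_M2 (f + g) = op_M2 f + op_M2 g"
proof -
  \<comment> \<open>\<open>div\<close> by a fixed polynomial is additive even where it is not exact,
    so linearity holds on all polynomials.\<close>
  show "op_L (f + g) = op_L f + op_L g"
    unfolding op_L_def shift_up_def shift_down_def pcompose_add poly_div_add_left [symmetric]
    by (rule arg_cong[where f = "\<lambda>h. h div _"]) algebra
  show "op_M1 (f + g) = op_M1 f + op_M1 g"
    unfolding op_M1_def shift_up_def shift_down_def pcompose_add poly_div_add_left [symmetric]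
    by (rule arg_cong[where f = "\<lambda>h. h div _"]) algebra
  show "op_M2 (f + g) = op_M2 f + op_M2 g"
    unfolding op_M2_def shift_up_def shift_down_def pcompose_add poly_div_add_left [symmetric]
    by (rule arg_cong[where f = "\<lambda>h. h div _"]) algebra
qed

lemma
  shows op_L_smult: "op_L (smult k f) = smult k (op_L f)"
    and op_M1_smult: "op_M1 (smult k f) = smult k (op_M1 f)"
    and op_M2_smult: "op_M2 (smult k f) = smult k (op_M2 f)"
  by (simp_all only: op_L_def op_M1_def op_M2_def shift_up_def shift_down_def pcompose_smult
      mult_smult_right smult_add_right[symmetric] smult_diff_right[symmetric] div_smult_left)

lemma even_polysI:
  assumes "finite S" and "\<And>x. x \<notin> S \<Longrightarrow> poly f (- x) = poly f x"
  shows "f \<in> even_polys"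
  unfolding even_polys_def mem_Collect_eq
  by (rule poly_eqI_cofinite[OF assms(1)]) (simp add: poly_pcompose assms(2))

lemma subspace_even_polys: "cpoly.subspace even_polys"
  by (rule cpoly.subspaceI) (simp_all add: even_polys_def pcompose_add pcompose_smult)

text \<open>Replacing \<open>x\<close> by \<open>- x\<close> interchanges the values of an even
  \<open>f\<close> at \<open>x + 1\<close> and \<open>x - 1\<close>; the two coefficients, divided
  by \<open>4 * x\<close>, are interchanged likewise.\<close>

lemma
  assumes "f \<in> even_polys"
  shows op_L_even: "op_L f \<in> even_polys"
    and op_M1_even: "op_M1 f \<in> even_polys"
    and op_M2_even: "op_M2 f \<in> even_polys"
proof -
  have *: "poly f (1 - x) = poly f (x - 1)" "poly f (- x - 1) = poly f (x + 1)" for x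
    using poly_even_polys[OF assms, of "x - 1"] poly_even_polys[OF assms, of "x + 1"]
    by simp_all
  show "op_L f \<in> even_polys"
    by (rule even_polysI[of "{0}"]) (simp_all add: poly_op_L[OF assms] * field_simps)
  show "op_M1 f \<in> even_polys"
    by (rule even_polysI[of "{0}"]) (simp_all add: poly_op_M1[OF assms] * field_simps)
  show "op_M2 f \<in> even_polys"
    by (rule even_polysI[of "{0}"]) (simp_all add: poly_op_M2[OF assms] * field_simps)
qed

text \<open>Both sides combine the values of \<open>f\<close> at \<open>x + 2\<close>,
  \<open>x\<close> and \<open>x - 2\<close>. With these as unknowns \<open>A\<close>,
  \<open>B\<close>, \<open>C\<close>, each relation is an identity of rational functions.\<close>

lemma
  assumes f: "f \<in> even_polys"
  shows op_relation_L_M1: "op_L (op_M1 f) - op_M1 (op_L f) = smult 2 (op_L (op_L f))"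
    and op_relation_L_M2:
      "op_L (op_M2 f) - op_M2 (op_L f) = op_M1 (op_L f) + op_L (op_M1 f)"
    and op_relation_M1_M2:
      "op_M1 (op_M2 f) - op_M2 (op_M1 f)
        = op_M2 (op_L f) + op_L (op_M2 f) - smult 4 (op_L (op_L f))"
proof -
  \<comment> \<open>The inner operators are evaluated at \<open>x + 1\<close> and
    \<open>x - 1\<close>, which adds the poles \<open>- 1\<close> and \<open>1\<close> to the pole
    \<open>0\<close>.\<close>
  have fin: "finite {0, 1, - 1 :: complex}"
    by simp
  have "poly (op_L (op_M1 f) - op_M1 (op_L f)) x = poly (smult 2 (op_L (op_L f))) x
      \<and> poly (op_L (op_M2 f) - op_M2 (op_L f)) x = poly (op_M1 (op_L f) + op_L (op_M1 f)) x
      \<and> poly (op_M1 (op_M2 f) - op_M2 (op_M1 f)) x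
        = poly (op_M2 (op_L f) + op_L (op_M2 f) - smult 4 (op_L (op_L f))) x"
    if "x \<notin> {0, 1, - 1}" for x
  proof -
    define y where "y = x + 1"
    define z where "z = x - 1"
    have nz: "x \<noteq> 0" "y \<noteq> 0" "z \<noteq> 0"
      using that by (auto simp: y_def z_def add_eq_0_iff2)
    have shift: "y - 1 = x" "z + 1 = x"
      by (simp_all add: y_def z_def)
    note at_x = poly_op_L[OF _ nz(1), folded y_def z_def] poly_op_M1[OF _ nz(1), folded y_def z_def]
      poly_op_M2[OF _ nz(1), folded y_def z_def]
    note at_y = poly_op_L[OF f nz(2), unfolded shift] poly_op_M1[OF f nz(2), unfolded shift]
      poly_op_M2[OF f nz(2), unfolded shift]
    note at_z = poly_op_L[OF f nz(3), unfolded shift] poly_op_M1[OF f nz(3), unfolded shift]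
      poly_op_M2[OF f nz(3), unfolded shift]
    define A B C where "A = poly f (y + 1)" and "B = poly f x" and "C = poly f (z - 1)"
    note evals = poly_diff poly_add poly_smult at_x[OF op_L_even[OF f]] at_x[OF op_M1_even[OF f]]
      at_x[OF op_M2_even[OF f]] at_y at_z A_def[symmetric] B_def[symmetric] C_def[symmetric]
    show ?thesis
    proof (intro conjI)
      show "poly (op_L (op_M1 f) - op_M1 (op_L f)) x = poly (smult 2 (op_L (op_L f))) x"
        unfolding evals using nz
        by (simp add: divide_simps) (unfold y_def z_def, algebra)
      show "poly (op_L (op_M2 f) - op_M2 (op_L f)) x = poly (op_M1 (op_L f) + op_L (op_M1 f)) x"
        unfolding evals using nz
        by (simp add: divide_simps) (unfold y_def z_def, algebra)
      show "poly (op_M1 (op_M2 f) - op_M2 (op_M1 f)) x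
          = poly (op_M2 (op_L f) + op_L (op_M2 f) - smult 4 (op_L (op_L f))) x"
        unfolding evals using nz
        by (simp add: divide_simps) (unfold y_def z_def, algebra)
    qed
  qed
  then show "op_L (op_M1 f) - op_M1 (op_L f) = smult 2 (op_L (op_L f))"
    "op_L (op_M2 f) - op_M2 (op_L f) = op_M1 (op_L f) + op_L (op_M1 f)"
    "op_M1 (op_M2 f) - op_M2 (op_M1 f)
      = op_M2 (op_L f) + op_L (op_M2 f) - smult 4 (op_L (op_L f))"
    by (blast intro: poly_eqI_cofinite[OF fin])+
qed

section \<open>The representation on even polynomials\<close>

fun gen_op :: "stab_gen \<Rightarrow> complex poly \<Rightarrow> complex poly"
  where "gen_op GL = op_L" | "gen_op GM1 = op_M1" | "gen_op GM2 = op_M2"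

text \<open>The last letter acts first, so that concatenation of words becomes composition.\<close>

definition word_op :: "stab_word \<Rightarrow> complex poly \<Rightarrow> complex poly"
  where "word_op w = foldr gen_op (letters w)"

definition free_op :: "stab_free \<Rightarrow> complex poly \<Rightarrow> complex poly"
  where "free_op p f = (\<Sum>w\<in>Poly_Mapping.keys p. smult (Poly_Mapping.lookup p w) (word_op w f))"

lemma word_op_add: "word_op w (f + g) = word_op w f + word_op w g"
proof -
  have "gen_op z (f + g) = gen_op z f + gen_op z g" for z f g
    by (cases z) (simp_all add: op_L_add op_M1_add op_M2_add)
  then have "foldr gen_op ws (f + g) = foldr gen_op ws f + foldr gen_op ws g" for ws
    by (induction ws) simp_all
  then show ?thesis
    by (simp add: word_op_def)
qed

lemma word_op_smult: "word_op w (smult k f) = smult k (word_op w f)"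
proof -
  have "gen_op z (smult k f) = smult k (gen_op z f)" for z f
    by (cases z) (simp_all add: op_L_smult op_M1_smult op_M2_smult)
  then have "foldr gen_op ws (smult k f) = smult k (foldr gen_op ws f)" for ws
    by (induction ws) simp_all
  then show ?thesis
    by (simp add: word_op_def)
qed

lemma word_op_plus: "word_op (v + w) f = word_op v (word_op w f)"
  by (simp add: word_op_def plus_stab_word_def)

lemma word_op_even:
  assumes "f \<in> even_polys"
  shows "word_op w f \<in> even_polys"
proof -
  have "gen_op z f \<in> even_polys" if "f \<in> even_polys" for z f
    using that by (cases z) (simp_all add: op_L_even op_M1_even op_M2_even)
  then have "foldr gen_op ws f \<in> even_polys" for ws
    by (induction ws) (simp_all add: assms)
  then show ?thesis
    by (simp add: word_op_def)
qed

text \<open>A common finite index set lets sums over different supports be added termwise.\<close>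

lemma free_op_superset:
  assumes "finite S" "Poly_Mapping.keys p \<subseteq> S"
  shows "free_op p f = (\<Sum>w\<in>S. smult (Poly_Mapping.lookup p w) (word_op w f))"
  unfolding free_op_def
  by (rule sum.mono_neutral_left) (use assms in \<open>auto simp: in_keys_iff\<close>)

section \<open>The action of the free algebra\<close>

lemma free_op_plus: "free_op (p + q) f = free_op p f + free_op q f"
proof -
  let ?S = "Poly_Mapping.keys p \<union> Poly_Mapping.keys q"
  have "free_op r f = (\<Sum>w\<in>?S. smult (Poly_Mapping.lookup r w) (word_op w f))"
    if "Poly_Mapping.keys r \<subseteq> ?S" for r
    using that by (intro free_op_superset) simp_all
  then show ?thesis
    by (simp add: keys_add lookup_add smult_add_left sum.distrib)
qed

lemma free_op_single: "free_op (Poly_Mapping.single w k) f = smult k (word_op w f)"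
  by (simp add: free_op_def)

lemma free_op_zero: "free_op 0 f = 0"
  by (simp add: free_op_def)

lemma free_op_one: "free_op 1 f = f"
proof -
  have "free_op 1 f = free_op (Poly_Mapping.single 0 1) f"
    by simp
  then show ?thesis
    unfolding free_op_single by (simp add: word_op_def zero_stab_word_def)
qed

lemma free_op_add: "free_op p (f + g) = free_op p f + free_op p g"
  by (simp add: free_op_def word_op_add smult_add_right sum.distrib)

lemma free_op_smult: "free_op p (smult k f) = smult k (free_op p f)"
  by (simp add: free_op_def word_op_smult cpoly.scale_sum_right mult.commute)

lemma free_op_minus: "free_op (p - q) f = free_op p f - free_op q f"
  using free_op_plus[of "p - q" q f] by simp

lemma free_op_even: "f \<in> even_polys \<Longrightarrow> free_op p f \<in> even_polys"
  unfolding free_op_def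
  by (intro cpoly.subspace_sum[OF subspace_even_polys] cpoly.subspace_scale[OF subspace_even_polys]
      word_op_even)

lemma poly_mapping_single_induct [case_names zero single add]:
  fixes p :: "'a \<Rightarrow>\<^sub>0 'b::comm_monoid_add"
  assumes "P 0" and "\<And>k v. P (Poly_Mapping.single k v)"
    and "\<And>p q. P p \<Longrightarrow> P q \<Longrightarrow> P (p + q)"
  shows "P p"
proof (induction p rule: update_induct)
  case const
  then show ?case by (rule assms)
next
  case (update f k v)
  have "Poly_Mapping.update k v f = f + Poly_Mapping.single k v"
    using update.hyps
    by (intro poly_mapping_eqI)
      (auto simp: lookup_update lookup_add lookup_single when_def in_keys_iff)
  then show ?case
    using update.IH by (simp add: assms)
qed

text \<open>Both sides are additive in \<open>p\<close> and in \<open>q\<close>, so it suffices to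
  compare multiples of single words, where concatenation acts by composition.\<close>

lemma free_op_times: "free_op (p * q) f = free_op p (free_op q f)"
proof (induction p rule: poly_mapping_single_induct)
  case zero
  show ?case by (simp add: free_op_zero)
next
  case (single w k)
  show ?case
  proof (induction q rule: poly_mapping_single_induct)
    case zero
    show ?case using free_op_smult[of _ 0 0] by (simp add: free_op_zero)
  next
    case (single w' k')
    show ?case
      by (simp add: mult_single free_op_single word_op_plus word_op_smult)
  next
    case (add p q)
    then show ?case by (simp add: distrib_left free_op_plus free_op_add)
  qed
next
  case (add p q)
  then show ?case by (simp add: distrib_right free_op_plus)
qed

lemma free_op_gen: "free_op (free_gen z) f = gen_op z f"
  by (simp add: free_gen_def free_op_single word_op_def)

lemma free_op_scale: "free_op (free_scale k p) f = smult k (free_op p f)"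
  by (simp add: free_scale_def free_op_times free_op_single word_op_def zero_stab_word_def)

lemma free_op_numeral: "free_op (numeral m) f = smult (numeral m) f"
  by (metis free_op_one free_op_scale free_scale_def mult.right_neutral single_numeral)

text \<open>The relators vanish by the three operator relations, which are available on even
  polynomials. For \<open>p * q\<close> with \<open>p\<close> in the ideal, the induction hypothesis
  is applied to \<open>free_op q f\<close>; hence the generalization over \<open>f\<close> and the
  use of \<open>free_op_even\<close>.\<close>

lemma free_op_ideal:
  assumes "p \<in> stab_ideal" "f \<in> even_polys"
  shows "free_op p f = 0"
  using assms
proof (induction arbitrary: f)
  case (stab_ideal_relator r)
  then show ?case
    using op_relation_L_M1[of f] op_relation_L_M2[of f] op_relation_M1_M2[of f]
    by (auto simp: stab_relators_def Let_def commutator_def anticommutator_def power2_eq_square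
        free_op_plus free_op_minus free_op_times free_op_gen free_op_numeral)
next
  case (stab_ideal_mult_left p q)
  then show ?case
    using free_op_smult[of q 0 0] by (simp add: free_op_times)
qed (simp_all add: free_op_zero free_op_plus free_op_times free_op_even)

text \<open>The ideal is only known to annihilate even polynomials; the default \<open>0\<close>
  elsewhere makes the map independent of the representative.\<close>

lift_definition stab_op :: "stab \<Rightarrow> complex poly \<Rightarrow> complex poly"
  is "\<lambda>p f. if f \<in> even_polys then free_op p f else 0"
proof
  fix p q :: stab_free and f
  assume "stab_eq p q"
  then show "(if f \<in> even_polys then free_op p f else 0)
    = (if f \<in> even_polys then free_op q f else 0)"
    using free_op_ideal[of "p - q" f] by (simp add: stab_eq_def free_op_minus)
qed

section \<open>The induced action of the quotient algebra\<close>

lemma stab_op_even: "f \<in> even_polys \<Longrightarrow> stab_op A f \<in> even_polys"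
  by transfer (simp add: free_op_even)

lemma stab_op_plus: "f \<in> even_polys \<Longrightarrow> stab_op (A + B) f = stab_op A f + stab_op B f"
  by transfer (simp add: free_op_plus)

lemma stab_op_scale: "f \<in> even_polys \<Longrightarrow> stab_op (stab_scale k A) f = smult k (stab_op A f)"
  by transfer (simp add: free_op_scale)

lemma stab_op_uminus: "f \<in> even_polys \<Longrightarrow> stab_op (- A) f = - stab_op A f"
  by transfer (use free_op_minus[of 0] in \<open>simp add: free_op_zero\<close>)

lemma
  assumes "f \<in> even_polys"
  shows stab_op_L: "stab_op stab_L f = op_L f"
    and stab_op_M1: "stab_op stab_M1 f = op_M1 f"
    and stab_op_M2: "stab_op stab_M2 f = op_M2 f"
  using assms by (transfer; simp add: free_op_gen)+

lemma stab_op_add: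
  "f \<in> even_polys \<Longrightarrow> g \<in> even_polys \<Longrightarrow> stab_op A (f + g) = stab_op A f + stab_op A g"
  by transfer (simp add: free_op_add cpoly.subspace_add[OF subspace_even_polys])

lemma stab_op_smult: "f \<in> even_polys \<Longrightarrow> stab_op A (smult k f) = smult k (stab_op A f)"
  by transfer (simp add: free_op_smult cpoly.subspace_scale[OF subspace_even_polys])

lemma stab_op_one: "f \<in> even_polys \<Longrightarrow> stab_op 1 f = f"
  by transfer (simp add: free_op_one)

lemma stab_op_times: "f \<in> even_polys \<Longrightarrow> stab_op (A * B) f = stab_op A (stab_op B f)"
  by transfer (simp add: free_op_times free_op_even)

lemma stab_representation_even_polys: "stab_representation even_polys stab_op"
  unfolding stab_representation_def
  by (intro conjI allI ballI subspace_even_polys stab_op_even stab_op_add stab_op_smult stab_op_one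
      stab_op_plus stab_op_scale stab_op_times)

text \<open>With \<open>u\<close>, \<open>v\<close>, \<open>w\<close> the coefficients in
  \<open>stab_P\<close>, the numerator at \<open>f(x + 1)\<close> is
  \<open>u + v (2x - 1) + w (2x^2 - 2x + 1) = x^2 + (s + t) x + s t\<close>. The one at
  \<open>f(x - 1)\<close> is its negative with \<open>x\<close> replaced by
  \<open>- x\<close>.\<close>

lemma poly_stab_op_P:
  assumes "f \<in> even_polys" "x \<noteq> 0"
  shows "poly (stab_op (stab_P s t) f) x =
    ((x + s) * (x + t) * poly f (x + 1) - (x - s) * (x - t) * poly f (x - 1)) / (4 * x)"
proof -
  have identity: "((1 + 2 * s) * (1 + 2 * t) - 1) / 4 * (A - B)
      + (1 + s + t) / 2 * ((2 * x - 1) * A + (2 * x + 1) * B)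
      + 1 / 2 * ((2 * x\<^sup>2 - 2 * x + 1) * A - (2 * x\<^sup>2 + 2 * x + 1) * B)
    = (x + s) * (x + t) * A - (x - s) * (x - t) * B" for A B
    by (simp add: field_simps power2_eq_square)
  have L: "4 * x * poly (op_L f) x = poly f (x + 1) - poly f (x - 1)"
    and M1: "4 * x * poly (op_M1 f) x =
      (2 * x - 1) * poly f (x + 1) + (2 * x + 1) * poly f (x - 1)"
    and M2: "4 * x * poly (op_M2 f) x =
      (2 * x\<^sup>2 - 2 * x + 1) * poly f (x + 1) - (2 * x\<^sup>2 + 2 * x + 1) * poly f (x - 1)"
    using assms by (simp_all add: poly_op_L poly_op_M1 poly_op_M2)
  have "poly (stab_op (stab_P s t) f) x = ((1 + 2 * s) * (1 + 2 * t) - 1) / 4 * poly (op_L f) x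
      + (1 + s + t) / 2 * poly (op_M1 f) x + 1 / 2 * poly (op_M2 f) x"
    using assms(1)
    by (simp add: stab_P_def stab_op_plus stab_op_scale stab_op_L stab_op_M1 stab_op_M2)
  then have "4 * x * poly (stab_op (stab_P s t) f) x
      = ((1 + 2 * s) * (1 + 2 * t) - 1) / 4 * (4 * x * poly (op_L f) x)
        + (1 + s + t) / 2 * (4 * x * poly (op_M1 f) x) + 1 / 2 * (4 * x * poly (op_M2 f) x)"
    by (simp add: algebra_simps)
  also have "\<dots> = (x + s) * (x + t) * poly f (x + 1) - (x - s) * (x - t) * poly f (x - 1)"
    unfolding L M1 M2 by (rule identity)
  finally show ?thesis
    using assms(2) by (simp add: eq_divide_eq mult.commute)
qed

section \<open>The span of the scaled Wilson polynomials\<close>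

text \<open>The three trailing Pochhammer symbols are empty; what remains depends on the parameters
  only through their sum.\<close>

lemma wilson_coeff_top:
  "wilson_coeff n a b c d n
    = pochhammer (- of_nat n) n * pochhammer (of_nat n + a + b + c + d - 1) n / fact n"
  by (simp add: wilson_coeff_def)

lemma pochhammer_linear_poly:
  fixes z :: complex
  assumes "z \<noteq> 0"
  shows "degree (pochhammer [:y, z:] k) = k" and "pochhammer [:y, z:] k \<noteq> 0"
proof -
  have "degree (pochhammer [:y, z:] k) = k \<and> pochhammer [:y, z:] k \<noteq> 0"
  proof (induction k)
    case (Suc k)
    define q where "q = [:y + of_nat k, z:]"
    have q: "degree q = 1" "q \<noteq> 0"
      using assms by (simp_all add: q_def)
    have "pochhammer [:y, z:] (Suc k) = pochhammer [:y, z:] k * q"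
      by (simp add: pochhammer_Suc q_def of_nat_poly)
    with Suc q show ?case
      by (simp add: degree_mult_eq)
  qed simp
  then show "degree (pochhammer [:y, z:] k) = k" and "pochhammer [:y, z:] k \<noteq> 0"
    by simp_all
qed

text \<open>Before scaling, basis function \<open>k\<close> has degree \<open>2 * k\<close>, so the
  top coefficient decides; substituting a nonzero multiple of \<open>x\<close> preserves the
  degree.\<close>

lemma degree_scaled_wilson:
  assumes "wilson_coeff n a b c d n \<noteq> 0"
  shows "degree (scaled_wilson n a b c d) = 2 * n"
proof -
  let ?t = "\<lambda>k. smult (wilson_coeff n a b c d k)
    (pochhammer [:a, \<i>:] k * pochhammer [:a, - \<i>:] k)"
  have deg: "degree (pochhammer [:a, \<i>:] k * pochhammer [:a, - \<i>:] k) = 2 * k" for k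
    by (simp add: degree_mult_eq pochhammer_linear_poly)
  have "wilson n a b c d = ?t n + (\<Sum>k<n. ?t k)"
    by (simp add: wilson_def flip: lessThan_Suc_atMost)
  moreover have "degree (?t n) = 2 * n"
    using assms deg by simp
  \<comment> \<open>For \<open>n = 0\<close> a strict bound is impossible, but then the sum is
    empty.\<close>
  moreover have "degree (\<Sum>k<n. ?t k) < 2 * n" if "n > 0"
    using that by (intro degree_sum_less) (auto simp: deg intro: le_less_trans[OF degree_smult_le])
  ultimately have "degree (wilson n a b c d) = 2 * n"
    by (cases "n = 0") (simp_all add: degree_add_eq_left)
  then show ?thesis
    by (simp add: scaled_wilson_def degree_pcompose)
qed

text \<open>For nonzero \<open>f\<close>, comparing leading coefficients after the substitution of
  \<open>- x\<close> forces \<open>(- 1) ^ degree f = 1\<close>.\<close>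

lemma even_degree_even_polys:
  assumes "f \<in> even_polys"
  shows "even (degree f)"
proof (cases "f = 0")
  case False
  have "lead_coeff (f \<circ>\<^sub>p [:0, - 1:]) = lead_coeff f"
    using assms by (simp add: even_polys_def)
  then have "lead_coeff f * (- 1) ^ degree f = lead_coeff f"
    by (simp add: lead_coeff_comp)
  with False show ?thesis
    by (cases "even (degree f)") auto
qed simp

text \<open>There is one Wilson polynomial in each even degree, so the leading term of an even
  polynomial can be cancelled and the degree descends.\<close>

lemma span_scaled_wilson:
  assumes "\<And>n. wilson_coeff n a b c d n \<noteq> 0"
  shows "cpoly.span (range (\<lambda>n. scaled_wilson n a b c d)) = even_polys" (is "cpoly.span ?W = _")
proof
  show "cpoly.span ?W \<subseteq> even_polys"
    by (rule cpoly.span_minimal) (auto simp: scaled_wilson_even subspace_even_polys)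
  show "even_polys \<subseteq> cpoly.span ?W"
  proof
    fix f assume "f \<in> even_polys"
    then show "f \<in> cpoly.span ?W"
    proof (induction "degree f" arbitrary: f rule: less_induct)
      case less
      show ?case
      proof (cases "f = 0")
        case True
        then show ?thesis by (simp add: cpoly.span_zero)
      next
        case False
        obtain n where n: "degree f = 2 * n"
          using even_degree_even_polys[OF less.prems] by blast
        define w where "w = scaled_wilson n a b c d"
        define k where "k = lead_coeff f / lead_coeff w"
        have degw: "degree w = 2 * n"
          unfolding w_def using assms by (rule degree_scaled_wilson)
        \<comment> \<open>Positive degree excludes zero; for \<open>n = 0\<close> the polynomial is
          the constant \<open>1\<close>.\<close>
        have "w \<noteq> 0"
        proof (cases "n = 0")
          case True
          then show ?thesis
            by (simp add: w_def scaled_wilson_def wilson_def wilson_coeff_def)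
        qed (use degw in auto)
        then have "coeff w (2 * n) \<noteq> 0"
          using degw leading_coeff_0_iff[of w] by simp
        then have k: "coeff (f - smult k w) (2 * n) = 0"
          using n degw by (simp add: k_def)
        have even: "f - smult k w \<in> even_polys"
          using less.prems unfolding w_def
          by (intro cpoly.subspace_diff cpoly.subspace_scale subspace_even_polys scaled_wilson_even)
        \<comment> \<open>A zero difference is treated separately: its degree \<open>0\<close> is
          not below \<open>2 * n\<close> when \<open>n = 0\<close>.\<close>
        have "f - smult k w \<in> cpoly.span ?W"
        proof (cases "f - smult k w = 0")
          case True
          then show ?thesis by (simp only: cpoly.span_zero)
        next
          case False
          have "degree (f - smult k w) \<le> 2 * n"
            using n degw by (intro degree_diff_le) simp_all
          moreover have "degree (f - smult k w) \<noteq> 2 * n"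
            using k False by (metis leading_coeff_0_iff)
          ultimately show ?thesis
            using less.hyps even n by simp
        qed
        moreover have "smult k w \<in> cpoly.span ?W"
          unfolding w_def by (intro cpoly.span_scale cpoly.span_base) simp
        ultimately have "(f - smult k w) + smult k w \<in> cpoly.span ?W"
          by (rule cpoly.span_add)
        then show ?thesis by simp
      qed
    qed
  qed
qed

section \<open>Action on the Wilson polynomials\<close>

definition wilson_basis :: "nat \<Rightarrow> complex \<Rightarrow> complex \<Rightarrow> complex"
  where "wilson_basis k a x = pochhammer (a - x / 2) k * pochhammer (a + x / 2) k"

lemma poly_scaled_wilson_basis:
  "poly (scaled_wilson n a b c d) x = (\<Sum>k\<le>n. wilson_coeff n a b c d k * wilson_basis k a x)"
  by (simp add: poly_scaled_wilson wilson_basis_def)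

section \<open>Recurrences and shifts of the Wilson basis\<close>

lemma wilson_basis_Suc:
  "wilson_basis (Suc k) a x = ((a + of_nat k)\<^sup>2 - x\<^sup>2 / 4) * wilson_basis k a x"
  by (simp add: wilson_basis_def pochhammer_Suc power2_eq_square field_simps)

text \<open>Moving \<open>x\<close> by one moves the bases of the two Pochhammer symbols by one half
  in opposite directions. Splitting off the first factor of one and the last factor of the other
  leaves both with \<open>a + 1/2\<close>.\<close>

lemma
  shows wilson_basis_Suc_plus_one: "wilson_basis (Suc k) a (x + 1)
      = (a - 1/2 - x / 2) * (a + 1/2 + of_nat k + x / 2) * wilson_basis k (a + 1/2) x"
    and wilson_basis_Suc_minus_one: "wilson_basis (Suc k) a (x - 1)
      = (a - 1/2 + x / 2) * (a + 1/2 + of_nat k - x / 2) * wilson_basis k (a + 1/2) x"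
proof -
  have shift: "a - (x + 1) / 2 + 1 = a + 1/2 - x / 2" "a + (x - 1) / 2 + 1 = a + 1/2 + x / 2"
    "a + (x + 1) / 2 = a + 1/2 + x / 2" "a - (x - 1) / 2 = a + 1/2 - x / 2"
    by (simp_all add: field_simps)
  have "wilson_basis (Suc k) a (x + 1) = (a - (x + 1) / 2) * pochhammer (a - (x + 1) / 2 + 1) k *
      (pochhammer (a + (x + 1) / 2) k * (a + (x + 1) / 2 + of_nat k))"
    by (simp add: wilson_basis_def pochhammer_rec[of "a - (x + 1) / 2"]
        pochhammer_Suc[of "a + (x + 1) / 2"])
  then show "wilson_basis (Suc k) a (x + 1)
      = (a - 1/2 - x / 2) * (a + 1/2 + of_nat k + x / 2) * wilson_basis k (a + 1/2) x"
    unfolding shift by (simp add: wilson_basis_def diff_divide_distrib add_divide_distrib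
        algebra_simps)
  have "wilson_basis (Suc k) a (x - 1) = pochhammer (a - (x - 1) / 2) k
      * (a - (x - 1) / 2 + of_nat k) * ((a + (x - 1) / 2) * pochhammer (a + (x - 1) / 2 + 1) k)"
    by (simp add: wilson_basis_def pochhammer_rec[of "a + (x - 1) / 2"]
        pochhammer_Suc[of "a - (x - 1) / 2"])
  then show "wilson_basis (Suc k) a (x - 1)
      = (a - 1/2 + x / 2) * (a + 1/2 + of_nat k - x / 2) * wilson_basis k (a + 1/2) x"
    unfolding shift by (simp add: wilson_basis_def diff_divide_distrib add_divide_distrib
        algebra_simps)
qed

text \<open>The linear factor on the left is, up to a factor of \<open>2\<close> or
  \<open>- 2\<close>, the one preceding a Pochhammer symbol whose base is too large by one.
  Absorbing it releases the last factor.\<close>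

lemma
  shows wilson_basis_plus_one: "(x + 2 * a - 1) * wilson_basis k a (x + 1)
      = (x + 2 * a - 1 + 2 * of_nat k) * wilson_basis k (a - 1/2) x"
    and wilson_basis_minus_one: "(x - 2 * a + 1) * wilson_basis k a (x - 1)
      = (x - 2 * a + 1 - 2 * of_nat k) * wilson_basis k (a - 1/2) x"
proof -
  have shift: "a - (x + 1) / 2 = a - 1/2 - x / 2" "a + (x + 1) / 2 = a - 1/2 + x / 2 + 1"
    "a - (x - 1) / 2 = a - 1/2 - x / 2 + 1" "a + (x - 1) / 2 = a - 1/2 + x / 2"
    by (simp_all add: field_simps)
  have rec: "y * pochhammer (y + 1) k = pochhammer y k * (y + of_nat k)" for y :: complex
    by (metis pochhammer_rec pochhammer_Suc)
  show "(x + 2 * a - 1) * wilson_basis k a (x + 1)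
      = (x + 2 * a - 1 + 2 * of_nat k) * wilson_basis k (a - 1/2) x"
    using rec[of "a - 1/2 + x / 2"] unfolding wilson_basis_def shift by algebra
  show "(x - 2 * a + 1) * wilson_basis k a (x - 1)
      = (x - 2 * a + 1 - 2 * of_nat k) * wilson_basis k (a - 1/2) x"
    using rec[of "a - 1/2 - x / 2"] unfolding wilson_basis_def shift by algebra
qed

text \<open>Both sides are \<open>pochhammer (y + of_nat k) (Suc (n - k))\<close>. The gain is that
  the split-off factor on the right is independent of \<open>k\<close>.\<close>

lemma pochhammer_shift_front:
  fixes y :: "'a::comm_ring_1"
  assumes "k \<le> n"
  shows "(y + of_nat k) * pochhammer (y + 1 + of_nat k) (n - k)
    = pochhammer (y + of_nat k) (n - k) * (y + of_nat n)"
proof -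
  have "(y + of_nat k) * pochhammer (y + of_nat k + 1) (n - k)
      = pochhammer (y + of_nat k) (n - k) * (y + of_nat k + of_nat (n - k))"
    by (metis pochhammer_rec pochhammer_Suc)
  then show ?thesis
    using assms by (simp add: of_nat_diff algebra_simps)
qed

text \<open>Differencing lowers the index of the basis by one. The factor \<open>Suc k\<close>
  reduces the factorial, and the first factors of the first two Pochhammer symbols form the
  prefactor.\<close>

lemma op_L_scaled_wilson_Suc:
  "smult 4 (op_L (scaled_wilson (Suc n) a b c d)) =
    smult (of_nat (Suc n) * (of_nat (Suc n) + (a + b + c + d) - 1))
      (scaled_wilson n (a + 1/2) (b + 1/2) (c + 1/2) (d + 1/2))"
proof (rule poly_eqI_cofinite[of "{0}"])
  fix x :: complex assume x: "x \<notin> {0}"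
  let ?N = "of_nat (Suc n) :: complex"
  let ?e = "a + b + c + d"
  let ?w = "wilson_coeff (Suc n) a b c d"
  let ?w' = "wilson_coeff n (a + 1/2) (b + 1/2) (c + 1/2) (d + 1/2)"
  let ?\<phi> = "\<lambda>k. wilson_basis k (a + 1/2) x"
  have basis: "wilson_basis (Suc k) a (x + 1) - wilson_basis (Suc k) a (x - 1)
      = - of_nat (Suc k) * x * ?\<phi> k" for k
    unfolding wilson_basis_Suc_plus_one wilson_basis_Suc_minus_one
    by (simp add: field_simps)
  have coeff: "- of_nat (Suc k) * ?w (Suc k) = ?N * (?N + ?e - 1) * ?w' k" for k
  proof -
    have fact: "of_nat (Suc k) / fact (Suc k) = (1 / fact k :: complex)"
      by (simp add: fact_Suc del: of_nat_Suc)
    have poch: "pochhammer (- ?N) (Suc k) = - ?N * pochhammer (- of_nat n) k"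
      "pochhammer (?N + a + b + c + d - 1) (Suc k) = (?N + ?e - 1) * pochhammer (?N + ?e) k"
      by (simp_all add: pochhammer_rec algebra_simps)
    have shift: "(y + 1/2) + (z + 1/2) + of_nat k = y + z + of_nat (Suc k)"
      "of_nat n + (a + 1/2) + (b + 1/2) + (c + 1/2) + (d + 1/2) - 1 = ?N + ?e" for y z :: complex
      by simp_all
    have "- of_nat (Suc k) * ?w (Suc k)
      = - (pochhammer (- ?N) (Suc k) * pochhammer (?N + a + b + c + d - 1) (Suc k)
        * (of_nat (Suc k) / fact (Suc k))
        * pochhammer (a + b + of_nat (Suc k)) (n - k) * pochhammer (a + c + of_nat (Suc k)) (n - k)
        * pochhammer (a + d + of_nat (Suc k)) (n - k))"
      unfolding wilson_coeff_def diff_Suc_Suc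
      by (simp only: times_divide_eq_left times_divide_eq_right mult_minus_left
        minus_divide_left ac_simps)
    also have "\<dots> = ?N * (?N + ?e - 1) * ?w' k"
      unfolding wilson_coeff_def shift fact poch by (simp del: of_nat_Suc)
    finally show ?thesis .
  qed
  have "poly (smult 4 (op_L (scaled_wilson (Suc n) a b c d))) x
      = (\<Sum>k\<le>Suc n. ?w k * (wilson_basis k a (x + 1) - wilson_basis k a (x - 1))) / x"
    using x by (simp add: poly_op_L scaled_wilson_even poly_scaled_wilson_basis
        right_diff_distrib[of "?w _"] sum_subtractf
        del: sum.atMost_Suc right_diff_distrib_numeral)
  \<comment> \<open>The summand \<open>k = 0\<close> vanishes because \<open>wilson_basis 0\<close>
    is constant, which permits the index shift.\<close>
  also have "\<dots> = (\<Sum>k\<le>n. ?w (Suc k) * (- of_nat (Suc k) * x * ?\<phi> k)) / x"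
    unfolding sum.atMost_Suc_shift basis by (simp add: wilson_basis_def)
  also have "\<dots> = (\<Sum>k\<le>n. (- of_nat (Suc k) * ?w (Suc k)) * ?\<phi> k)"
    using x unfolding sum_divide_distrib by (intro sum.cong) simp_all
  also have "\<dots> = ?N * (?N + ?e - 1) * (\<Sum>k\<le>n. ?w' k * ?\<phi> k)"
    unfolding coeff by (simp only: sum_distrib_left mult.assoc)
  finally show "poly (smult 4 (op_L (scaled_wilson (Suc n) a b c d))) x
      = poly (smult (?N * (?N + ?e - 1))
        (scaled_wilson n (a + 1/2) (b + 1/2) (c + 1/2) (d + 1/2))) x"
    by (simp only: poly_smult poly_scaled_wilson_basis)
qed simp

lemma op_L_scaled_wilson_0: "op_L (scaled_wilson 0 a b c d) = 0"
  by (rule poly_eqI_cofinite[of "{0}"])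
    (simp_all add: poly_op_L scaled_wilson_even poly_scaled_wilson)

section \<open>The elements \<open>stab_P\<close> acting on Wilson polynomials\<close>

lemma poly_stab_op_P_scaled_wilson:
  assumes "x \<noteq> 0"
  shows "poly (stab_op (stab_P s t) (scaled_wilson n a b c d)) x =
    (\<Sum>k\<le>n. wilson_coeff n a b c d k
      * (((x + s) * (x + t) * wilson_basis k a (x + 1)
          - (x - s) * (x - t) * wilson_basis k a (x - 1)) / (4 * x)))"
  unfolding poly_stab_op_P[OF scaled_wilson_even assms] poly_scaled_wilson_basis
    sum_distrib_left sum_subtractf[symmetric] sum_divide_distrib
  by (intro sum.cong) (simp_all add: algebra_simps)

text \<open>Each basis function goes to a multiple of a single one. The multiplier
  \<open>a + b - 1 + k\<close> merges with the Pochhammer symbol in \<open>a + b\<close>, while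
  \<open>a + c\<close>, \<open>a + d\<close> and the parameter sum are unchanged by the
  shift.\<close>

lemma stab_op_P_a_b_scaled_wilson:
  "stab_op (stab_P (2 * a - 1) (2 * b - 1)) (scaled_wilson n a b c d) =
    smult (of_nat n + a + b - 1) (scaled_wilson n (a - 1/2) (b - 1/2) (c + 1/2) (d + 1/2))"
proof (rule poly_eqI_cofinite[of "{0}"])
  fix x :: complex assume x: "x \<notin> {0}"
  let ?w = "wilson_coeff n a b c d"
  let ?w' = "wilson_coeff n (a - 1/2) (b - 1/2) (c + 1/2) (d + 1/2)"
  let ?\<phi> = "\<lambda>k. wilson_basis k (a - 1/2) x"
  have basis: "((x + (2 * a - 1)) * (x + (2 * b - 1)) * wilson_basis k a (x + 1)
      - (x - (2 * a - 1)) * (x - (2 * b - 1)) * wilson_basis k a (x - 1)) / (4 * x)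
    = (a + b - 1 + of_nat k) * ?\<phi> k" for k
  proof -
    have "(x + (2 * a - 1)) * (x + (2 * b - 1)) * wilson_basis k a (x + 1)
        - (x - (2 * a - 1)) * (x - (2 * b - 1)) * wilson_basis k a (x - 1)
      = (x + 2 * b - 1) * ((x + 2 * a - 1) * wilson_basis k a (x + 1))
        - (x - 2 * b + 1) * ((x - 2 * a + 1) * wilson_basis k a (x - 1))"
      by (simp add: algebra_simps)
    also have "\<dots> = 4 * x * ((a + b - 1 + of_nat k) * ?\<phi> k)"
      unfolding wilson_basis_plus_one wilson_basis_minus_one by (simp add: algebra_simps)
    finally show ?thesis
      using x by simp
  qed
  have coeff: "?w k * (a + b - 1 + of_nat k) = (of_nat n + a + b - 1) * ?w' k" if "k \<le> n" for k
  proof -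
    have "(a + b - 1 + of_nat k) * pochhammer (a + b + of_nat k) (n - k)
        = pochhammer (a - 1/2 + (b - 1/2) + of_nat k) (n - k) * (of_nat n + a + b - 1)"
      using pochhammer_shift_front[OF that, of "a + b - 1"] by (simp add: algebra_simps)
    moreover have "of_nat n + (a - 1/2) + (b - 1/2) + (c + 1/2) + (d + 1/2) - 1
        = of_nat n + a + b + c + d - 1"
      "a - 1/2 + (c + 1/2) + of_nat k = a + c + of_nat k"
      "a - 1/2 + (d + 1/2) + of_nat k = a + d + of_nat k"
      by simp_all
    ultimately show ?thesis
      unfolding wilson_coeff_def by algebra
  qed
  have "poly (stab_op (stab_P (2 * a - 1) (2 * b - 1)) (scaled_wilson n a b c d)) x
      = (\<Sum>k\<le>n. (?w k * (a + b - 1 + of_nat k)) * ?\<phi> k)"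
    using x unfolding mult.assoc[of "?w _"] by (simp add: poly_stab_op_P_scaled_wilson basis)
  also have "\<dots> = (of_nat n + a + b - 1) * (\<Sum>k\<le>n. ?w' k * ?\<phi> k)"
    unfolding sum_distrib_left by (intro sum.cong) (simp_all add: coeff)
  finally show "poly (stab_op (stab_P (2 * a - 1) (2 * b - 1)) (scaled_wilson n a b c d)) x
      = poly (smult (of_nat n + a + b - 1)
        (scaled_wilson n (a - 1/2) (b - 1/2) (c + 1/2) (d + 1/2))) x"
    by (simp only: poly_smult poly_scaled_wilson_basis)
qed simp

text \<open>Each basis function of positive index yields two, so coefficient \<open>k\<close> of the
  image collects contributions from the indices \<open>k\<close> and \<open>Suc k\<close>.\<close>

lemma stab_op_P_c_d_scaled_wilson:
  "stab_op (stab_P (2 * c - 1) (2 * d - 1)) (scaled_wilson n a b c d) =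
    smult (of_nat n + c + d - 1) (scaled_wilson n (a + 1/2) (b + 1/2) (c - 1/2) (d - 1/2))"
proof (rule poly_eqI_cofinite[of "{0}"])
  fix x :: complex assume x: "x \<notin> {0}"
  let ?w = "wilson_coeff n a b c d"
  let ?w' = "wilson_coeff n (a + 1/2) (b + 1/2) (c - 1/2) (d - 1/2)"
  let ?\<phi> = "\<lambda>k. wilson_basis k (a + 1/2) x"
  define \<psi> where "\<psi> k = ((x + (2 * c - 1)) * (x + (2 * d - 1)) * wilson_basis k a (x + 1)
      - (x - (2 * c - 1)) * (x - (2 * d - 1)) * wilson_basis k a (x - 1)) / (4 * x)" for k
  have basis_0: "\<psi> 0 = (c + d - 1) * ?\<phi> 0"
    using x by (simp add: \<psi>_def wilson_basis_def field_simps)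
  have basis_Suc: "\<psi> (Suc k) = (c + d - 1 + of_nat (Suc k)) * ?\<phi> (Suc k)
      - of_nat (Suc k) * (a + c + of_nat k) * (a + d + of_nat k) * ?\<phi> k" for k
  proof -
    have identity: "(x + (2 * c - 1)) * (x + (2 * d - 1))
          * ((a - 1/2 - x / 2) * (a + 1/2 + K + x / 2) * F)
        - (x - (2 * c - 1)) * (x - (2 * d - 1))
          * ((a - 1/2 + x / 2) * (a + 1/2 + K - x / 2) * F)
      = 4 * x * ((c + d - 1 + (1 + K)) * (((a + 1/2 + K)\<^sup>2 - x\<^sup>2 / 4) * F)
        - (1 + K) * (a + c + K) * (a + d + K) * F)" for K F
      by (simp add: power2_eq_square divide_simps) algebra
    have "(x + (2 * c - 1)) * (x + (2 * d - 1)) * wilson_basis (Suc k) a (x + 1)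
        - (x - (2 * c - 1)) * (x - (2 * d - 1)) * wilson_basis (Suc k) a (x - 1)
      = 4 * x * ((c + d - 1 + of_nat (Suc k)) * ?\<phi> (Suc k)
        - of_nat (Suc k) * (a + c + of_nat k) * (a + d + of_nat k) * ?\<phi> k)"
      unfolding wilson_basis_Suc_plus_one wilson_basis_Suc_minus_one
        wilson_basis_Suc[of k "a + 1/2"] of_nat_Suc
      by (rule identity)
    then show ?thesis
      using x by (simp add: \<psi>_def)
  qed
  have coeff: "?w k * (c + d - 1 + of_nat k)
      - ?w (Suc k) * (of_nat (Suc k) * (a + c + of_nat k) * (a + d + of_nat k))
    = (of_nat n + c + d - 1) * ?w' k" if "k < n" for k
  proof -
    \<comment> \<open>This makes \<open>n - k\<close> a successor, so that a factor can be split off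
      at either end.\<close>
    obtain m where m: "n = Suc (k + m)"
      using less_imp_Suc_add[OF \<open>k < n\<close>] by blast
    let ?e = "of_nat n + a + b + c + d - 1"
    have fact: "of_nat (Suc k) / fact (Suc k) = (1 / fact k :: complex)"
      by (simp add: fact_Suc del: of_nat_Suc)
    have poch: "pochhammer (y + of_nat k) (n - k)
        = (y + of_nat k) * pochhammer (y + of_nat (Suc k)) (n - Suc k)" for y :: complex
      using m by (simp add: pochhammer_rec algebra_simps)
    have pochb: "pochhammer (a + 1/2 + (b + 1/2) + of_nat k) (n - k)
        = pochhammer (a + b + of_nat (Suc k)) (n - Suc k) * (a + b + of_nat n)"
      using m by (simp add: pochhammer_Suc algebra_simps)
    have e: "of_nat n + (a + 1/2) + (b + 1/2) + (c - 1/2) + (d - 1/2) - 1 = ?e"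
      "a + 1/2 + (c - 1/2) + of_nat k = a + c + of_nat k"
      "a + 1/2 + (d - 1/2) + of_nat k = a + d + of_nat k"
      by simp_all
    \<comment> \<open>\<open>X\<close> is the common factor of the three coefficients. Without it,
      \<open>A = a + b\<close> and \<open>C = c + d - 1\<close> leave
      \<open>(A + k)(C + k) + (n - k)(n + A + C + k) = (n + A)(n + C)\<close>.\<close>
    define X where "X = pochhammer (- of_nat n) k * pochhammer ?e k / fact k
        * pochhammer (a + b + of_nat (Suc k)) (n - Suc k)
        * pochhammer (a + c + of_nat k) (n - k) * pochhammer (a + d + of_nat k) (n - k)"
    have w: "?w k = X * (a + b + of_nat k)"
      unfolding wilson_coeff_def X_def poch[of "a + b"]
      by (simp only: times_divide_eq_left times_divide_eq_right ac_simps)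
    have w_Suc: "?w (Suc k) * (of_nat (Suc k) * (a + c + of_nat k) * (a + d + of_nat k))
      = X * (- of_nat n + of_nat k) * (?e + of_nat k)"
    proof -
      have "?w (Suc k) * (of_nat (Suc k) * (a + c + of_nat k) * (a + d + of_nat k))
        = pochhammer (- of_nat n) (Suc k) * pochhammer ?e (Suc k) * (of_nat (Suc k) / fact (Suc k))
          * pochhammer (a + b + of_nat (Suc k)) (n - Suc k)
          * ((a + c + of_nat k) * pochhammer (a + c + of_nat (Suc k)) (n - Suc k))
          * ((a + d + of_nat k) * pochhammer (a + d + of_nat (Suc k)) (n - Suc k))"
        unfolding wilson_coeff_def by (simp only: times_divide_eq_left times_divide_eq_right ac_simps)
      also have "\<dots> = X * (- of_nat n + of_nat k) * (?e + of_nat k)"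
        unfolding fact poch[symmetric] X_def pochhammer_Suc
        by (simp only: times_divide_eq_left times_divide_eq_right mult_1_left ac_simps)
      finally show ?thesis .
    qed
    have w': "?w' k = X * (a + b + of_nat n)"
      unfolding wilson_coeff_def X_def pochb e
      by (simp only: times_divide_eq_left times_divide_eq_right ac_simps)
    show ?thesis
      unfolding w w_Suc w' by algebra
  qed
  \<comment> \<open>No index above \<open>n\<close> contributes here, and the shift preserves the
    parameter sum, so the two top coefficients coincide.\<close>
  have coeff_top: "?w n * (c + d - 1 + of_nat n) = (of_nat n + c + d - 1) * ?w' n"
    by (simp add: wilson_coeff_top algebra_simps)
  \<comment> \<open>In a partial sum all coefficients below \<open>m\<close> are final; the one at
    \<open>m\<close> still lacks the contribution of \<open>\<psi> (Suc m)\<close>.\<close>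
  have telescope: "(\<Sum>k\<le>m. ?w k * \<psi> k) = ?w m * (c + d - 1 + of_nat m) * ?\<phi> m
      + (\<Sum>k<m. (of_nat n + c + d - 1) * ?w' k * ?\<phi> k)" if "m \<le> n" for m
    using that
  proof (induction m)
    case 0
    show ?case by (simp add: basis_0)
  next
    case (Suc m)
    have top: "(of_nat n + c + d - 1) * ?w' m = ?w m * (c + d - 1 + of_nat m)
        - ?w (Suc m) * (of_nat (Suc m) * (a + c + of_nat m) * (a + d + of_nat m))"
      using coeff[of m] Suc.prems by simp
    show ?case
      unfolding sum.atMost_Suc sum.lessThan_Suc Suc.IH[OF Suc_leD[OF Suc.prems]] basis_Suc top
      by (simp add: algebra_simps del: of_nat_Suc)
  qed
  have "poly (stab_op (stab_P (2 * c - 1) (2 * d - 1)) (scaled_wilson n a b c d)) x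
      = (\<Sum>k\<le>n. ?w k * \<psi> k)"
    using x by (simp add: poly_stab_op_P_scaled_wilson \<psi>_def)
  also have "\<dots> = (of_nat n + c + d - 1) * (\<Sum>k\<le>n. ?w' k * ?\<phi> k)"
    unfolding telescope[OF order_refl] coeff_top sum_distrib_left
    by (simp add: mult.assoc flip: lessThan_Suc_atMost)
  finally show "poly (stab_op (stab_P (2 * c - 1) (2 * d - 1)) (scaled_wilson n a b c d)) x
      = poly (smult (of_nat n + c + d - 1)
        (scaled_wilson n (a + 1/2) (b + 1/2) (c - 1/2) (d - 1/2))) x"
    by (simp only: poly_smult poly_scaled_wilson_basis)
qed simp

text \<open>\<open>stab_P\<close> acts through the quadratic \<open>(x + s) * (x + t)\<close>, and a
  constant there acts as a multiple of \<open>op_L\<close>. The weights add up to one, which matches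
  the squares; the condition on \<open>\<sigma>\<close> matches the linear terms, and the last
  coefficient is a quarter of the remaining constant discrepancy.\<close>

lemma stab_op_P_combination:
  fixes a b c d \<sigma> :: complex
  assumes f: "f \<in> even_polys" and \<sigma>: "\<sigma> * (a + b - c - d) = 1"
  shows "stab_op (stab_P (2 * c) (2 * d)) f =
    smult \<sigma> (stab_op (stab_P (2 * a - 1) (2 * b - 1)) f)
    + smult (1 - \<sigma>) (stab_op (stab_P (2 * c - 1) (2 * d - 1)) f)
    - smult (\<sigma> * (a * b - c * d) - (c + d) / 2 - 1 / 4) (smult 4 (op_L f))"
proof (rule poly_eqI_cofinite[of "{0}"])
  fix x :: complex assume x: "x \<notin> {0}"
  have quad: "(x + 2 * c) * (x + 2 * d) = \<sigma> * ((x + (2 * a - 1)) * (x + (2 * b - 1)))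
      + (1 - \<sigma>) * ((x + (2 * c - 1)) * (x + (2 * d - 1)))
      - 4 * (\<sigma> * (a * b - c * d) - (c + d) / 2 - 1 / 4)" for x
    using \<sigma> by (simp add: divide_simps) algebra
  have quad': "(x - 2 * c) * (x - 2 * d) = \<sigma> * ((x - (2 * a - 1)) * (x - (2 * b - 1)))
      + (1 - \<sigma>) * ((x - (2 * c - 1)) * (x - (2 * d - 1)))
      - 4 * (\<sigma> * (a * b - c * d) - (c + d) / 2 - 1 / 4)" for x
    using quad[of "- x"] by (simp add: algebra_simps)
  define K where "K = \<sigma> * (a * b - c * d) - (c + d) / 2 - 1 / 4"
  show "poly (stab_op (stab_P (2 * c) (2 * d)) f) x = poly
    (smult \<sigma> (stab_op (stab_P (2 * a - 1) (2 * b - 1)) f)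
    + smult (1 - \<sigma>) (stab_op (stab_P (2 * c - 1) (2 * d - 1)) f)
    - smult (\<sigma> * (a * b - c * d) - (c + d) / 2 - 1 / 4) (smult 4 (op_L f))) x"
    using x unfolding K_def[symmetric]
    by (simp add: poly_stab_op_P[OF f] poly_op_L[OF f] quad quad' flip: K_def)
      (simp add: divide_simps, algebra)
qed simp

theorem proposition3:
  fixes a b c d \<sigma> e\<^sub>1 :: real and V :: "complex poly set" and \<mu> \<mu>' \<tau> :: stab
  assumes "a > 0" "b > 0" "c > 0" "d > 0"
    and "a + b \<noteq> c + d"
    and "\<sigma> = inverse (a + b - c - d)"
    and "e\<^sub>1 = a + b + c + d"
    and "V = cpoly.span (range (\<lambda>n. scaled_wilson n a b c d))"
    and "\<mu> = - stab_P (2 * a - 1) (2 * b - 1)"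
    and "\<mu>' = - stab_P (2 * c) (2 * d)"
    and "\<tau> = stab_scale 4 stab_L"
  shows "\<exists>\<rho>. stab_representation V \<rho> \<and>
    (\<forall>f\<in>V. \<rho> stab_L f = op_L f \<and> \<rho> stab_M1 f = op_M1 f \<and> \<rho> stab_M2 f = op_M2 f) \<and>
    (\<forall>n::nat.
      \<rho> \<mu> (scaled_wilson n a b c d) =
        smult (- (n + a + b - 1)) (scaled_wilson n (a - 1/2) (b - 1/2) (c + 1/2) (d + 1/2)) \<and>
      \<rho> \<tau> (scaled_wilson n a b c d) =
        (if n = 0 then 0
         else smult (n * (n + e\<^sub>1 - 1))
           (scaled_wilson (n - 1) (a + 1/2) (b + 1/2) (c + 1/2) (d + 1/2))) \<and>
      \<rho> \<mu>' (scaled_wilson n a b c d) =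
        smult (- \<sigma> * (n + a + b - 1))
          (scaled_wilson n (a - 1/2) (b - 1/2) (c + 1/2) (d + 1/2))
        + smult (- (1 - \<sigma>) * (n + c + d - 1))
          (scaled_wilson n (a + 1/2) (b + 1/2) (c - 1/2) (d - 1/2))
        + (if n = 0 then 0
           else smult ((\<sigma> * (a * b - c * d) - (c + d) / 2 - 1 / 4) * (n * (n + e\<^sub>1 - 1)))
             (scaled_wilson (n - 1) (a + 1/2) (b + 1/2) (c + 1/2) (d + 1/2))))"
proof (intro exI[of _ stab_op] conjI allI ballI)
  let ?W = "scaled_wilson"
  \<comment> \<open>For \<open>n \<ge> 1\<close> positivity of the parameters makes every factor
    \<open>n + a + b + c + d - 1 + j\<close> positive; for \<open>n = 0\<close> the product is
    empty.\<close>
  have top: "wilson_coeff n a b c d n \<noteq> 0" for n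
  proof (cases n)
    case (Suc m)
    have "complex_of_real (real n + a + b + c + d - 1 + real j) \<noteq> 0" for j
      using assms(1-4) Suc by (subst of_real_eq_0_iff) simp
    then have "pochhammer (of_nat n + a + b + c + d - 1 :: complex) n \<noteq> 0"
      by (auto simp: pochhammer_eq_0_iff eq_neg_iff_add_eq_0)
    moreover have "pochhammer (- of_nat n :: complex) n \<noteq> 0"
      by (simp add: pochhammer_same)
    ultimately show ?thesis
      by (simp add: wilson_coeff_top)
  qed (simp add: wilson_coeff_def)
  have V: "V = even_polys"
    unfolding assms(8) using top by (rule span_scaled_wilson)
  show "stab_representation V stab_op"
    unfolding V by (rule stab_representation_even_polys)
  show "stab_op stab_L f = op_L f" "stab_op stab_M1 f = op_M1 f" "stab_op stab_M2 f = op_M2 f"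
    if "f \<in> V" for f
    using that by (simp_all add: V stab_op_L stab_op_M1 stab_op_M2)
  fix n :: nat
  have tau: "smult 4 (op_L (?W n a b c d)) =
      (if n = 0 then 0
       else smult (n * (n + e\<^sub>1 - 1)) (?W (n - 1) (a + 1/2) (b + 1/2) (c + 1/2) (d + 1/2)))"
    by (cases n) (simp_all add: op_L_scaled_wilson_0 op_L_scaled_wilson_Suc assms(7))
  show "stab_op \<mu> (?W n a b c d) =
      smult (- (n + a + b - 1)) (?W n (a - 1/2) (b - 1/2) (c + 1/2) (d + 1/2))"
    by (simp add: assms(9) stab_op_uminus scaled_wilson_even stab_op_P_a_b_scaled_wilson
        flip: smult_minus_left)
  show "stab_op \<tau> (?W n a b c d) =
      (if n = 0 then 0
       else smult (n * (n + e\<^sub>1 - 1)) (?W (n - 1) (a + 1/2) (b + 1/2) (c + 1/2) (d + 1/2)))"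
    unfolding assms(11) tau[symmetric] by (simp add: stab_op_scale stab_op_L scaled_wilson_even)
  have "\<sigma> * (a + b - c - d) = 1"
    using assms(5,6) by simp
  then have \<sigma>: "complex_of_real \<sigma>
      * (complex_of_real a + complex_of_real b - complex_of_real c - complex_of_real d) = 1"
    by (metis of_real_1 of_real_add of_real_diff of_real_mult)
  \<comment> \<open>Since \<open>\<mu>'\<close> is the negative of \<open>stab_P\<close>, the two
    shifted terms turn negative and the \<open>op_L\<close> term positive.\<close>
  have combine: "- (smult s (smult m A) + smult r (smult k B) - smult K T)
      = smult (- s * m) A + smult (- r * k) B + smult K T"
    for s m r k K :: complex and A B T :: "complex poly"
    by simp
  have "stab_op \<mu>' (?W n a b c d)
      = - stab_op (stab_P (2 * complex_of_real c) (2 * complex_of_real d)) (?W n a b c d)"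
    by (simp add: assms(10) stab_op_uminus scaled_wilson_even)
  also have "\<dots> =
      smult (- complex_of_real \<sigma> * (of_nat n + complex_of_real a + complex_of_real b - 1))
        (?W n (a - 1/2) (b - 1/2) (c + 1/2) (d + 1/2))
      + smult (- (1 - complex_of_real \<sigma>) * (of_nat n + complex_of_real c + complex_of_real d - 1))
        (?W n (a + 1/2) (b + 1/2) (c - 1/2) (d - 1/2))
      + smult (\<sigma> * (a * b - c * d) - (c + d) / 2 - 1 / 4) (smult 4 (op_L (?W n a b c d)))"
    unfolding stab_op_P_combination[OF scaled_wilson_even \<sigma>] stab_op_P_a_b_scaled_wilson
      stab_op_P_c_d_scaled_wilson combine
    by simp
  finally show "stab_op \<mu>' (?W n a b c d) =
      smult (- \<sigma> * (n + a + b - 1)) (?W n (a - 1/2) (b - 1/2) (c + 1/2) (d + 1/2))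
      + smult (- (1 - \<sigma>) * (n + c + d - 1)) (?W n (a + 1/2) (b + 1/2) (c - 1/2) (d - 1/2))
      + (if n = 0 then 0
         else smult ((\<sigma> * (a * b - c * d) - (c + d) / 2 - 1 / 4) * (n * (n + e\<^sub>1 - 1)))
           (?W (n - 1) (a + 1/2) (b + 1/2) (c + 1/2) (d + 1/2)))"
    unfolding tau by simp
qed

end
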